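(* Let $p\ge 5$ and let $\tau=1324\ldots p\in S_p$ be the permutation obtained from the identity by interchanging $2$ and $3$ (so $\tau=1\,3\,2\,4\,5\cdots p$). Then, as formal power series in $t$, $$NM_\tau(t,x,y)=\left(\frac{1}{U_\tau(t,y)}\right)^x,\qquad U_\tau(t,y)=1+\sum_{n\ge 1}U_{\tau,n}(y)\frac{t^n}{n!},$$ where $U_{\tau,1}(y)=-y$ and for all $n\ge 2$, $$U_{\tau,n}(y)=(1-y)U_{\tau,n-1}(y)+\sum_{k=1}^{\lfloor\frac{n-2}{p-2}\rfloor}(-y)^{k}\,U_{\tau,n-(k(p-2)+1)}(y).$$
   Context: For a sequence $\sigma$ of distinct integers, $\mathrm{red}(\sigma)$ is the permutation obtained by replacing the $i$-th smallest integer appearing in $\sigma$ by $i$. For $\tau\in S_j$, a permutation $\sigma=\sigma_1\cdots\sigma_n\in S_n$ has a $\tau$-match starting at position $i$ if $\mathrm{red}(\sigma_i\sigma_{i+1}\cdots\sigma_{i+j-1})=\tau$. $\mathcal{NM}_n(\tau)$ is the set of $\sigma\in S_n$ with no $\tau$-matches. $\mathrm{des}(\sigma)=|\{i:\sigma_i>\sigma_{i+1}\}|$. An entry $\sigma_j$ is a left-to-right minimum of $\sigma$ if $\sigma_j<\sigma_i$ for all $i<j$ (so $\sigma_1$ is always one), and $\mathrm{LRmin}(\sigma)$ is the number of left-to-right minima. Set $$NM_\tau(t,x,y)=1+\sum_{n\ge1}\frac{t^n}{n!}\sum_{\sigma\in\mathcal{NM}_n(\tau)}x^{\mathrm{LRmin}(\sigma)}y^{1+\mathrm{des}(\sigma)}.$$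 For a power series $U$ in $t$ with constant term $1$, $(1/U)^x$ means $\exp(-x\log U)$ as a formal power series in $t$. *)

theory Defs
  imports Complex_Main
    "HOL-Computational_Algebra.Formal_Power_Series"
    "HOL-Combinatorics.Multiset_Permutations"
begin

text \<open>
  Permutations in $S_n$ are given in one-line notation, as the lists in
  \<^term>\<open>permutations_of_set {1..n::nat}\<close>. List positions count from 0.
\<close>

definition red :: "'a::linorder list \<Rightarrow> nat list" where
  "red s = map (\<lambda>a. card {b \<in> set s. b \<le> a}) s"

definition match_at :: "nat list \<Rightarrow> 'a::linorder list \<Rightarrow> nat \<Rightarrow> bool" where
  "match_at \<tau> s i \<longleftrightarrow>
     i + length \<tau> \<le> length s \<and> red (take (length \<tau>) (drop i s)) = \<tau>"

definition NM_set :: "nat list \<Rightarrow> nat \<Rightarrow> nat list set" where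
  "NM_set \<tau> n = {s \<in> permutations_of_set {1..n}. \<not> (\<exists>i. match_at \<tau> s i)}"

definition des :: "'a::linorder list \<Rightarrow> nat" where
  "des s = card {i. Suc i < length s \<and> s ! i > s ! Suc i}"

definition LRmin :: "'a::linorder list \<Rightarrow> nat" where
  "LRmin s = card {j. j < length s \<and> (\<forall>i<j. s ! j < s ! i)}"

text \<open>
  The series in $t$ have coefficients in an arbitrary field of characteristic 0,
  and $x$, $y$ are arbitrary elements of it. This includes the case of two
  indeterminates: the type \<open>rat poly poly fract\<close> is an instance of
  \<^class>\<open>field_char_0\<close>.
\<close>

definition NM_series :: "nat list \<Rightarrow> 'a::field_char_0 \<Rightarrow> 'a \<Rightarrow> 'a fps" where
  "NM_series \<tau> x y =
     Abs_fps (\<lambda>n. if n = 0 then 1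
       else (\<Sum>s\<in>NM_set \<tau> n. x ^ LRmin s * y ^ (1 + des s)) / fact n)"

text \<open>
  \<^term>\<open>fps_ln 1\<close> is the series of $\log(1+t)$, so \<open>fps_log U\<close> is $\log U$
  when $U$ has constant term 1.
\<close>

definition fps_log :: "'a::field_char_0 fps \<Rightarrow> 'a fps" where
  "fps_log U = fps_ln 1 oo (U - 1)"

definition fps_recip_powr :: "'a::field_char_0 fps \<Rightarrow> 'a \<Rightarrow> 'a fps" where
  "fps_recip_powr U x = fps_exp 1 oo (- fps_const x * fps_log U)"

definition tau :: "nat \<Rightarrow> nat list" where
  "tau p = [1, 3, 2] @ [4..<Suc p]"

text \<open>
  The value at index 0 is the constant term of the series \<open>U_series\<close>; the
  recurrence at $n \ge 2$ only refers to indices from 1 to $n-1$.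
\<close>

fun U_coeff :: "nat \<Rightarrow> 'a::field_char_0 \<Rightarrow> nat \<Rightarrow> 'a" where
  "U_coeff p y n =
     (if n = 0 then 1
      else if n = 1 then - y
      else (1 - y) * U_coeff p y (n - 1)
           + (\<Sum>k = 1..(n - 2) div (p - 2).
                (- y) ^ k * U_coeff p y (n - (k * (p - 2) + 1))))"

declare U_coeff.simps [simp del]

definition U_series :: "nat \<Rightarrow> 'a::field_char_0 \<Rightarrow> 'a fps" where
  "U_series p y = Abs_fps (\<lambda>n. U_coeff p y n / fact n)"

end

theory Submission
  imports Defs
begin

text \<open>
  Write $\tau$ for \<open>tau p\<close>. Because $\tau$ begins with its smallest entry, a match in
  $\sigma = \alpha\,1\,\beta$ lies either inside $\alpha$ or inside $1\,\beta$: an occurrence using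
  the entry 1 must begin there. If $\alpha$ is not empty,
  then $1 + \mathrm{des}$ of $\sigma$ is the sum of its values for $\alpha$ and $1\,\beta$, and
  $1\,\beta$ contributes exactly one left-to-right minimum. So $N = NM_\tau(t,x,y)$ satisfies
  $N' = x\,N\,B'$, where $B$ enumerates the $\tau$-avoiding permutations that begin with 1 by
  $y^{1 + \mathrm{des}}$ (\<open>egf_full_weight_deriv\<close>). Hence
  $N = \exp(x B)$, and the theorem reduces to the case $x = 1$, namely
  $U_\tau(t,y) \cdot NM_\tau(t,1,y) = 1$.

  Exponential generating functions multiply like weights on words under deconcatenation
  (\<open>egf_mult\<close>), so that identity follows from a cancellation within each single permutation,
  with a weight \<open>brick_weight\<close> whose generating function is $U_\tau$. This weight is the sum of
  $(-y)^k$ over the ways to cut the word into $k$ increasing bricks such that, where one brick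
  follows another, either the word ascends at the cut or the two bricks together contain a
  $\tau$-match. As 3 2 is the only descent of $\tau$, such a match consists of the last two entries
  of one brick and the first $p - 2$ entries of the next. The cancellation
  (\<open>brick_avoid_convolution\<close>) reflects a sign-reversing pairing: a valid row of bricks
  followed by a $\tau$-avoiding word is changed by moving the initial run of that word to the row
  as a new brick, or by moving the last brick back.

  It remains to sum the brick weight over all permutations (\<open>U_coeff_eq_perm_sum\<close>). In a valid
  row the first entries of the bricks increase, so 1 comes first. If 2 comes next, then removing
  1 gives the factor $1 - y$. Otherwise the word begins with 1 3 2 and the brick that begins with
  2 has at least $p - 2 \ge 3$ entries. This forces the first $p - 3$ of them to be the smallest
  values left, 2, 4, \<open>\<dots>\<close>, $p - 1$. The last of these then takes the role of 1: either the
  smallest value left comes next, or the same configuration occurs again. The number of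
  occurrences is the summation index $k$ of the recurrence.
\<close>

section \<open>Order-invariant weights on lists\<close>

text \<open>
  A permutation of any finite set of numbers can be relabelled to one of \<open>{1..n}\<close>. The weights
  below depend only on the relative order of the entries, so their sums over the permutations of
  a set depend only on its cardinality.
\<close>

definition order_invariant :: "(nat list \<Rightarrow> 'a) \<Rightarrow> bool" where
  "order_invariant f \<longleftrightarrow> (\<forall>h s. strict_mono_on (set s) h \<longrightarrow> f (map h s) = f s)"

definition perm_sum :: "(nat list \<Rightarrow> 'a::comm_monoid_add) \<Rightarrow> nat set \<Rightarrow> 'a" where
  "perm_sum f A = (\<Sum>s\<in>permutations_of_set A. f s)"

lemma order_invariantD:
  "order_invariant f \<Longrightarrow> strict_mono_on (set s) h \<Longrightarrow> f (map h s) = f s"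
  by (auto simp: order_invariant_def)

lemma perm_sum_cong:
  "(\<And>s. distinct s \<Longrightarrow> set s = A \<Longrightarrow> f s = g s) \<Longrightarrow> perm_sum f A = perm_sum g A"
  unfolding perm_sum_def by (intro sum.cong) (auto simp: permutations_of_set_def)

lemma length_eqI: "distinct s \<Longrightarrow> set s = {1..n} \<Longrightarrow> length s = n"
  using distinct_card[of s] by simp

lemma perm_sum_image:
  assumes "order_invariant f" "strict_mono_on A h"
  shows "perm_sum f (h ` A) = perm_sum f A"
proof -
  have inj: "inj_on h A"
    using assms(2) by (rule strict_mono_on_imp_inj_on)
  have "inj_on (map h) (permutations_of_set A)"
    by (rule inj_onI) (use inj in \<open>auto simp: permutations_of_set_def intro: map_inj_on\<close>)
  then have "perm_sum f (h ` A) = (\<Sum>s\<in>permutations_of_set A. f (map h s))"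
    unfolding perm_sum_def permutations_of_set_image_inj[OF inj] by (simp add: sum.reindex)
  also have "\<dots> = perm_sum f A"
    unfolding perm_sum_def
    by (intro sum.cong order_invariantD[OF assms(1)])
      (use assms(2) in \<open>auto simp: permutations_of_set_def\<close>)
  finally show ?thesis .
qed

lemma perm_sum_eq_card:
  assumes "order_invariant f" "finite A"
  shows "perm_sum f A = perm_sum f {1..card A}"
proof -
  define h where "h i = sorted_list_of_set A ! (i - 1)" for i
  have mono: "strict_mono_on {1..card A} h"
  proof (rule strict_mono_onI)
    fix r s assume "r \<in> {1..card A}" "s \<in> {1..card A}" "r < s"
    then show "h r < h s"
      unfolding h_def
      by (intro sorted_wrt_nth_less[OF strict_sorted_list_of_set]) auto
  qed
  have "h ` {1..card A} = A"
  proof (rule card_subset_eq)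
    have "h i \<in> A" if "i \<in> {1..card A}" for i
      using that assms(2) nth_mem[of "i - 1" "sorted_list_of_set A"] by (auto simp: h_def)
    then show "h ` {1..card A} \<subseteq> A"
      by auto
    show "card (h ` {1..card A}) = card A"
      using strict_mono_on_imp_inj_on[OF mono] by (simp add: card_image)
  qed (use assms in simp)
  with perm_sum_image[OF assms(1) mono] show ?thesis
    by simp
qed

text \<open>
  Cutting a permutation of \<open>A\<close> after \<open>k\<close> entries amounts to choosing the set \<open>B\<close> of the
  first \<open>k\<close> entries and permuting \<open>B\<close> and its complement independently.
\<close>

lemma sum_take_drop:
  fixes f g :: "nat list \<Rightarrow> 'a::comm_ring_1"
  assumes "finite A" "k \<le> card A"
  shows "(\<Sum>s\<in>permutations_of_set A. f (take k s) * g (drop k s)) =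
         (\<Sum>B | B \<subseteq> A \<and> card B = k. perm_sum f B * perm_sum g (A - B))"
proof -
  let ?S = "SIGMA B:{B. B \<subseteq> A \<and> card B = k}. permutations_of_set B \<times> permutations_of_set (A - B)"
  have fin: "finite {B. B \<subseteq> A \<and> card B = k}"
    using assms(1) by simp
  have "(\<Sum>B | B \<subseteq> A \<and> card B = k. perm_sum f B * perm_sum g (A - B)) =
        (\<Sum>B | B \<subseteq> A \<and> card B = k.
           \<Sum>(s, t)\<in>permutations_of_set B \<times> permutations_of_set (A - B). f s * g t)"
    by (simp add: perm_sum_def sum_product sum.cartesian_product)
  also have "\<dots> = (\<Sum>(B, s, t)\<in>?S. f s * g t)"
    by (subst sum.Sigma[OF fin]) auto
  also have "\<dots> = (\<Sum>s\<in>permutations_of_set A. f (take k s) * g (drop k s))"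
  proof (rule sum.reindex_bij_witness[where i = "\<lambda>s. (set (take k s), take k s, drop k s)"
        and j = "\<lambda>(B, s, t). s @ t"])
    fix s assume s: "s \<in> permutations_of_set A"
    then have d: "distinct s" "set s = A"
      by (auto simp: permutations_of_set_def)
    then have "length s = card A"
      using distinct_card[of s] by simp
    with d assms have c: "card (set (take k s)) = k"
      by (simp add: distinct_card)
    have "set (take k s) \<inter> set (drop k s) = {}" "set (take k s) \<union> set (drop k s) = A"
      using d by (metis append_take_drop_id distinct_append, metis append_take_drop_id set_append)
    with d c show "(set (take k s), take k s, drop k s) \<in> ?S"
      by (auto simp: permutations_of_set_def)
  qed (auto simp: permutations_of_set_def distinct_card)
  finally show ?thesis ..
qed

definition egf :: "(nat list \<Rightarrow> 'a::field_char_0) \<Rightarrow> 'a fps" where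
  "egf f = Abs_fps (\<lambda>n. perm_sum f {1..n} / fact n)"

text \<open>
  A subset of the values for the first part of the word can be chosen in \<open>n choose k\<close> ways, and
  by order invariance each choice contributes the same, which is the binomial convolution of
  the coefficients. This reduces identities between series to identities for one word at a time.
\<close>

lemma egf_mult:
  fixes f g :: "nat list \<Rightarrow> 'a::field_char_0"
  assumes "order_invariant f" "order_invariant g"
  shows "egf f * egf g = egf (\<lambda>s. \<Sum>k\<le>length s. f (take k s) * g (drop k s))"
proof (rule fps_ext)
  fix n
  have split: "(\<Sum>s\<in>permutations_of_set {1..n}. f (take k s) * g (drop k s)) =
      of_nat (n choose k) * (perm_sum f {1..k} * perm_sum g {1..n - k})" if "k \<le> n" for k
  proof -
    have "(\<Sum>s\<in>permutations_of_set {1..n}. f (take k s) * g (drop k s)) =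
        (\<Sum>B | B \<subseteq> {1..n} \<and> card B = k. perm_sum f B * perm_sum g ({1..n} - B))"
      using that by (intro sum_take_drop) auto
    also have "\<dots> = (\<Sum>B | B \<subseteq> {1..n} \<and> card B = k. perm_sum f {1..k} * perm_sum g {1..n - k})"
    proof (rule sum.cong, goal_cases)
      case (2 B)
      then have "finite B" "B \<subseteq> {1..n}" "card B = k"
        by (auto intro: finite_subset)
      then show ?case
        using perm_sum_eq_card[OF assms(1), of B] perm_sum_eq_card[OF assms(2), of "{1..n} - B"]
        by (simp add: card_Diff_subset)
    qed simp
    also have "\<dots> = of_nat (n choose k) * (perm_sum f {1..k} * perm_sum g {1..n - k})"
      using n_subsets[of "{1..n}" k] by simp
    finally show ?thesis .
  qed
  have "perm_sum (\<lambda>s. \<Sum>k\<le>length s. f (take k s) * g (drop k s)) {1..n} =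
      perm_sum (\<lambda>s. \<Sum>k\<le>n. f (take k s) * g (drop k s)) {1..n}"
    by (rule perm_sum_cong) (simp only: length_eqI)
  also have "\<dots> = (\<Sum>k\<le>n. \<Sum>s\<in>permutations_of_set {1..n}. f (take k s) * g (drop k s))"
    unfolding perm_sum_def by (rule sum.swap)
  also have "\<dots> = (\<Sum>k\<le>n. of_nat (n choose k) * (perm_sum f {1..k} * perm_sum g {1..n - k}))"
    by (intro sum.cong refl split) simp
  finally have *: "perm_sum (\<lambda>s. \<Sum>k\<le>length s. f (take k s) * g (drop k s)) {1..n} =
      (\<Sum>k\<le>n. of_nat (n choose k) * (perm_sum f {1..k} * perm_sum g {1..n - k}))" .
  show "fps_nth (egf f * egf g) n =
      fps_nth (egf (\<lambda>s. \<Sum>k\<le>length s. f (take k s) * g (drop k s))) n"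
    unfolding fps_mult_nth egf_def fps_nth_Abs_fps * sum_divide_distrib atLeast0AtMost
    by (intro sum.cong refl) (simp add: binomial_fact)
qed

lemma perm_sum_insert:
  assumes "finite A" "a \<notin> A"
  shows "perm_sum f (insert a A) = perm_sum (\<lambda>s. \<Sum>k\<le>card A. f (take k s @ a # drop k s)) A"
proof -
  have tw: "takeWhile (\<lambda>b. b \<noteq> a) (u @ a # v) = u" "remove1 a (u @ a # v) = u @ v"
    if "a \<notin> set u" for u v
    using that by (induction u) auto
  have len: "length s = card A" if "s \<in> permutations_of_set A" for s
    using that by (auto simp: permutations_of_set_def distinct_card)
  have dec: "\<exists>u v. t = u @ a # v \<and> a \<notin> set u \<and> a \<notin> set v" 
    if "t \<in> permutations_of_set (insert a A)" for t
    using that split_list[of a t] by (fastforce simp: permutations_of_set_def)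
  have "perm_sum (\<lambda>s. \<Sum>k\<le>card A. f (take k s @ a # drop k s)) A =
     (\<Sum>(s, k)\<in>permutations_of_set A \<times> {..card A}. f (take k s @ a # drop k s))"
    by (simp add: perm_sum_def sum.cartesian_product)
  also have "\<dots> = (\<Sum>t\<in>permutations_of_set (insert a A). f t)"
  proof (rule sum.reindex_bij_witness[where j = "\<lambda>(s, k). take k s @ a # drop k s"
        and i = "\<lambda>t. (remove1 a t, length (takeWhile (\<lambda>b. b \<noteq> a) t))"], goal_cases)
    case (1 sk)
    then obtain s k where sk: "sk = (s, k)" "s \<in> permutations_of_set A" "k \<le> card A"
      by auto
    then have "a \<notin> set s"
      using assms by (auto simp: permutations_of_set_def)
    then have "a \<notin> set (take k s)"
      using in_set_takeD by metis
    with sk show ?case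
      using len[of s] by (simp add: tw)
  next
    case (2 sk)
    then obtain s k where sk: "sk = (s, k)" "distinct s" "set s = A"
      by (auto simp: permutations_of_set_def)
    have d: "set (take k s) \<inter> set (drop k s) = {}" and u: "set (take k s) \<union> set (drop k s) = A"
      using sk set_take_disj_set_drop_if_distinct[of s k k]
      by (simp, metis append_take_drop_id set_append)
    with assms have "a \<notin> set (take k s)" "a \<notin> set (drop k s)"
      by auto
    with d u sk(1,2) show ?case
      by (simp add: permutations_of_set_def)
  next
    case (3 t)
    then obtain u v where "t = u @ a # v" "a \<notin> set u" "a \<notin> set v"
      using dec by blast
    then show ?case
      by (simp add: tw)
  next
    case (4 t)
    then obtain u v where uv: "t = u @ a # v" "a \<notin> set u" "a \<notin> set v"
      using dec by blast
    then have "u @ v \<in> permutations_of_set A"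
      using 4 assms by (auto simp: permutations_of_set_def)
    with uv len[of "u @ v"] show ?case
      by (simp add: tw)
  next
    case (5 sk)
    then show ?case by auto
  qed
  finally show ?thesis
    by (simp add: perm_sum_def)
qed

text \<open>
  With 0 as the minimum in place of 1, deleting the minimum leaves a permutation of \<open>{1..n}\<close>,
  which keeps later computations free of relabellings.
\<close>

lemma perm_sum_insert_min:
  assumes "order_invariant f"
  shows "perm_sum f {1..Suc n} = perm_sum (\<lambda>s. \<Sum>k\<le>n. f (take k s @ 0 # drop k s)) {1..n}"
proof -
  have "perm_sum f {1..Suc n} = perm_sum f (insert 0 {1..n})"
    using perm_sum_eq_card[OF assms, of "insert 0 {1..n}"] by simp
  also have "\<dots> = perm_sum (\<lambda>s. \<Sum>k\<le>n. f (take k s @ 0 # drop k s)) {1..n}"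
    by (subst perm_sum_insert) auto
  finally show ?thesis .
qed

text \<open>
  The form used for the brick weight, which vanishes unless the minimum comes first.
\<close>

lemma perm_sum_min_head:
  assumes "order_invariant f"
    and "\<And>u v. distinct (u @ 0 # v) \<Longrightarrow> u \<noteq> [] \<Longrightarrow> f (u @ 0 # v) = 0"
  shows "perm_sum f {1..Suc n} = perm_sum (\<lambda>s. f (0 # s)) {1..n}"
  unfolding perm_sum_insert_min[OF assms(1)]
proof (rule perm_sum_cong)
  fix s :: "nat list" assume s: "distinct s" "set s = {1..n}"
  then have len: "length s = n"
    by (rule length_eqI)
  have "f (take k s @ 0 # drop k s) = 0" if "k \<in> {..n} - {0}" for k
  proof (rule assms(2))
    have "set (take k s) \<inter> set (drop k s) = {}"
      using s by (simp add: set_take_disj_set_drop_if_distinct)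
    moreover have "0 \<notin> set (take k s)" "0 \<notin> set (drop k s)"
      using s in_set_takeD[of 0 k s] in_set_dropD[of 0 k s] by auto
    ultimately show "distinct (take k s @ 0 # drop k s)"
      using s by simp
    show "take k s \<noteq> []"
      using that len by auto
  qed
  then have "(\<Sum>k\<le>n. f (take k s @ 0 # drop k s)) = (\<Sum>k\<in>{0}. f (take k s @ 0 # drop k s))"
    by (intro sum.mono_neutral_right) auto
  then show "(\<Sum>k\<le>n. f (take k s @ 0 # drop k s)) = f (0 # s)"
    by simp
qed

lemma egf_deriv:
  assumes "order_invariant f"
  shows "fps_deriv (egf f) = egf (\<lambda>s. \<Sum>k\<le>length s. f (take k s @ 0 # drop k s))"
proof (rule fps_ext)
  fix n
  have "perm_sum f {1..Suc n} = perm_sum (\<lambda>s. \<Sum>k\<le>length s. f (take k s @ 0 # drop k s)) {1..n}"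
    unfolding perm_sum_insert_min[OF assms]
    by (rule perm_sum_cong) (simp only: length_eqI)
  then show "fps_nth (fps_deriv (egf f)) n =
      fps_nth (egf (\<lambda>s. \<Sum>k\<le>length s. f (take k s @ 0 # drop k s))) n"
    by (simp add: egf_def divide_simps del: of_nat_Suc)
qed

section \<open>Matches of the pattern\<close>

lemma red_map:
  assumes "strict_mono_on (set s) h"
  shows "red (map h s) = red s"
proof -
  have "card {b \<in> h ` set s. b \<le> h a} = card {b \<in> set s. b \<le> a}" if "a \<in> set s" for a
  proof -
    have "{b \<in> h ` set s. b \<le> h a} = h ` {b \<in> set s. b \<le> a}"
      using that strict_mono_on_less_eq[OF assms] by auto
    moreover have "inj_on h {b \<in> set s. b \<le> a}"
      using strict_mono_on_imp_inj_on[OF assms] by (rule inj_on_subset) auto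
    ultimately show ?thesis
      by (simp add: card_image)
  qed
  then show ?thesis
    by (auto simp: red_def)
qed

lemma length_red [simp]: "length (red s) = length s"
  by (simp add: red_def)

lemma red_nth_less_iff:
  assumes "i < length s" "j < length s"
  shows "red s ! i < red s ! j \<longleftrightarrow> s ! i < s ! j"
proof (cases "s ! i < s ! j")
  case True
  then have "s ! j \<in> {b \<in> set s. b \<le> s ! j} - {b \<in> set s. b \<le> s ! i}"
    and "{b \<in> set s. b \<le> s ! i} \<subseteq> {b \<in> set s. b \<le> s ! j}"
    using assms by auto
  then have "{b \<in> set s. b \<le> s ! i} \<subset> {b \<in> set s. b \<le> s ! j}"
    by blast
  then have "card {b \<in> set s. b \<le> s ! i} < card {b \<in> set s. b \<le> s ! j}"
    by (intro psubset_card_mono) auto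
  with True assms show ?thesis
    by (simp add: red_def)
next
  case False
  then have "{b \<in> set s. b \<le> s ! j} \<subseteq> {b \<in> set s. b \<le> s ! i}"
    by auto
  then have "card {b \<in> set s. b \<le> s ! j} \<le> card {b \<in> set s. b \<le> s ! i}"
    by (intro card_mono) auto
  with False assms show ?thesis
    by (simp add: red_def)
qed

text \<open>
  One direction of order isomorphism is enough: for distinct entries a failure of the converse
  would reverse a strict inequality. The pattern is compared with a window in this way.
\<close>

lemma red_eqI:
  assumes "distinct s" "distinct t" "length s = length t"
    and less: "\<And>i j. i < length s \<Longrightarrow> j < length s \<Longrightarrow> s ! i < s ! j \<Longrightarrow> t ! i < t ! j"
  shows "red s = red t"
proof (rule nth_equalityI)
  fix i assume "i < length (red s)"
  then have i: "i < length s"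
    by simp
  have nth_image: "card {b \<in> set u. b \<le> u ! i} = card {j. j < length u \<and> u ! j \<le> u ! i}"
    if "distinct u" for u :: "'c::linorder list"
  proof -
    have "{b \<in> set u. b \<le> u ! i} = (!) u ` {j. j < length u \<and> u ! j \<le> u ! i}"
      by (auto simp: in_set_conv_nth)
    moreover have "inj_on ((!) u) {j. j < length u \<and> u ! j \<le> u ! i}"
      by (rule inj_on_nth) (use that in auto)
    ultimately show ?thesis
      by (simp add: card_image)
  qed
  have "s ! j \<le> s ! i \<longleftrightarrow> t ! j \<le> t ! i" if "j < length s" for j
    using less[OF i that] less[OF that i] assms(1-3) i that
    by (metis linorder_less_linear nth_eq_iff_index_eq order.order_iff_strict order.asym)
  then have "{j. j < length s \<and> s ! j \<le> s ! i} = {j. j < length t \<and> t ! j \<le> t ! i}"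
    using assms(3) by auto
  with i assms(1-3) show "red s ! i = red t ! i"
    by (simp add: red_def nth_image)
qed (use assms(3) in simp)

lemma length_tau [simp]: "3 \<le> p \<Longrightarrow> length (tau p) = p"
  by (auto simp: tau_def)

lemma nth_tau:
  assumes "3 \<le> p" "i < p"
  shows "tau p ! i = (if i = 1 then 3 else if i = 2 then 2 else Suc i)"
proof -
  consider "i = 0" | "i = 1" | "i = 2" | "3 \<le> i"
    by linarith
  then show ?thesis
    using assms by cases (auto simp: tau_def nth_append)
qed

lemma distinct_tau: "distinct (tau p)"
  by (auto simp: tau_def)

lemma red_tau:
  assumes "3 \<le> p"
  shows "red (tau p) = tau p"
proof -
  have set_tau: "set (tau p) = {1..p}"
    using assms by (auto simp: tau_def)
  have "card {b \<in> {1..p}. b \<le> a} = a" if "a \<in> {1..p}" for a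
  proof -
    have "{b \<in> {1..p}. b \<le> a} = {1..a}"
      using that by auto
    then show ?thesis
      by simp
  qed
  then show ?thesis
    unfolding red_def set_tau by (intro map_idI) (simp add: set_tau)
qed

text \<open>
  The relations that the pattern 1 3 2 4 imposes on a word \<open>a # b # r\<close>.
\<close>

definition dip :: "'a::linorder \<Rightarrow> 'a \<Rightarrow> 'a list \<Rightarrow> bool" where
  "dip a b r \<longleftrightarrow> 2 \<le> length r \<and> a < r ! 0 \<and> r ! 0 < b \<and> b < r ! 1"

definition rising :: "nat \<Rightarrow> 'a::linorder list \<Rightarrow> bool" where
  "rising j r \<longleftrightarrow> j \<le> length r \<and> sorted_wrt (<) (take j r)"

text \<open>
  After its first two entries, \<open>tau p\<close> is increasing with \<open>p - 2\<close> entries, and its second entry 3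
  lies between the first two of these.
\<close>

lemma match_at_tau_0:
  assumes "4 \<le> p" "distinct (a # b # r)"
  shows "match_at (tau p) (a # b # r) 0 \<longleftrightarrow> dip a b r \<and> rising (p - 2) r"
proof (cases "p - 2 \<le> length r")
  case True
  define R where "R = take (p - 2) r"
  have lenR: "length R = p - 2"
    using True by (simp add: R_def)
  have t: "take p (a # b # r) = a # b # R"
    using assms(1) by (simp add: R_def take_Cons' numeral_2_eq_2)
  have R: "r ! 0 = R ! 0" "r ! 1 = R ! 1"
    using assms(1) by (simp_all add: R_def)
  have dist: "distinct (a # b # R)"
    using assms(2) by (auto simp: R_def dest: in_set_takeD)
  have "match_at (tau p) (a # b # r) 0 \<longleftrightarrow> red (a # b # R) = tau p"
    using True assms(1) t by (auto simp: match_at_def)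
  also have "\<dots> \<longleftrightarrow> a < R ! 0 \<and> R ! 0 < b \<and> b < R ! 1 \<and> sorted_wrt (<) R"
  proof safe
    assume "red (a # b # R) = tau p"
    then have *: "(a # b # R) ! i < (a # b # R) ! j \<longleftrightarrow> tau p ! i < tau p ! j"
      if "i < p" "j < p" for i j
      using red_nth_less_iff[of i "a # b # R" j] that lenR by simp
    show "a < R ! 0" "R ! 0 < b" "b < R ! 1"
      using *[of 0 2] *[of 2 1] *[of 1 3] assms(1) by (simp_all add: nth_tau)
    show "sorted_wrt (<) R"
      unfolding sorted_wrt_iff_nth_less
    proof safe
      fix i j assume "i < j" "j < length R"
      then show "R ! i < R ! j"
        using *[of "i + 2" "j + 2"] lenR assms(1) by (simp add: nth_tau)
    qed
  next
    assume h: "a < R ! 0" "R ! 0 < b" "b < R ! 1" "sorted_wrt (<) R"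
    have mono: "R ! i < R ! j" if "i < j" "j < length R" for i j
      using h(4) that by (simp add: sorted_wrt_iff_nth_less)
    have aR: "a < R ! i" if "i < length R" for i
      using h(1) mono[of 0 i] that by (cases "i = 0") auto
    have bR: "b < R ! i" if "i < length R" "1 \<le> i" for i
      using h(3) mono[of 1 i] that by (cases "i = 1") auto
    have "red (tau p) = red (a # b # R)"
    proof (rule red_eqI)
      fix i j assume ij: "i < length (tau p)" "j < length (tau p)" "tau p ! i < tau p ! j"
      then have *: "i < p" "j < p"
        "(if i = 1 then 3 else if i = 2 then 2 else Suc i) <
         (if j = 1 then 3 else if j = 2 then 2 else Suc j)"
        using assms(1) by (simp_all add: nth_tau)
      have j: "j \<noteq> 0"
        using *(3) by (auto split: if_splits)
      have "i = 0 \<or> i = 1 \<and> 3 \<le> j \<or> i = 2 \<and> j = 1 \<or> 2 \<le> i \<and> i < j"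
        using *(3) j by (simp split: if_splits) presburger
      then consider "i = 0" | "i = 1" "3 \<le> j" | "i = 2" "j = 1" | "2 \<le> i" "i < j"
        by blast
      then show "(a # b # R) ! i < (a # b # R) ! j"
      proof cases
        case 1
        then show ?thesis
          using j *(2) lenR aR h by (cases "j = 1") (auto simp: nth_Cons')
      next
        case 2
        then show ?thesis
          using bR[of "j - 2"] * lenR by (simp add: nth_Cons' numeral_2_eq_2)
      next
        case 3
        then show ?thesis
          using h by simp
      next
        case 4
        then show ?thesis
          using mono[of "i - 2" "j - 2"] * lenR by (simp add: nth_Cons' numeral_2_eq_2)
      qed
    qed (use dist distinct_tau lenR assms(1) in auto)
    then show "red (a # b # R) = tau p"
      using red_tau[of p] assms(1) by simp
  qed
  also have "\<dots> \<longleftrightarrow> dip a b r \<and> rising (p - 2) r"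
    using True assms(1) by (auto simp: dip_def rising_def R[simplified One_nat_def] R_def[symmetric])
  finally show ?thesis .
next
  case False
  then show ?thesis
    using assms(1) by (auto simp: match_at_def rising_def)
qed

lemma match_at_Cons_Suc: "match_at \<tau> (a # s) (Suc i) \<longleftrightarrow> match_at \<tau> s i"
  by (simp add: match_at_def)

lemma match_at_map:
  assumes "strict_mono_on (set s) h"
  shows "match_at \<tau> (map h s) i \<longleftrightarrow> match_at \<tau> s i"
proof -
  have "set (take (length \<tau>) (drop i s)) \<subseteq> set s"
    by (meson order.trans set_drop_subset set_take_subset)
  then have "red (map h (take (length \<tau>) (drop i s))) = red (take (length \<tau>) (drop i s))"
    by (intro red_map monotone_on_subset[OF assms])
  then show ?thesis
    by (simp add: match_at_def drop_map take_map)
qed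

lemma des_Nil [simp]: "des [] = 0"
  and des_single [simp]: "des [a] = 0"
  by (simp_all add: des_def)

lemma des_Cons_Cons: "des (a # b # r) = of_bool (b < a) + des (b # r)"
proof -
  have "{i. Suc i < length (a # b # r) \<and> (a # b # r) ! i > (a # b # r) ! Suc i} =
      (if b < a then {0} else {}) \<union> Suc ` {i. Suc i < length (b # r) \<and> (b # r) ! i > (b # r) ! Suc i}"
    (is "?L = ?M \<union> Suc ` ?R")
  proof (rule set_eqI)
    fix i
    show "i \<in> ?L \<longleftrightarrow> i \<in> ?M \<union> Suc ` ?R"
      by (cases i) auto
  qed
  moreover have "card (?M \<union> Suc ` ?R) = of_bool (b < a) + card ?R"
    by (subst card_Un_disjoint) (auto simp: card_image)
  ultimately show ?thesis
    by (simp add: des_def)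
qed

lemma des_map:
  assumes "strict_mono_on (set s) h"
  shows "des (map h s) = des s"
proof -
  have "h (s ! Suc i) < h (s ! i) \<longleftrightarrow> s ! Suc i < s ! i" if "Suc i < length s" for i
    using that by (intro strict_mono_on_less[OF assms]) auto
  then show ?thesis
    unfolding des_def by (intro arg_cong[where f = card]) auto
qed

lemma LRmin_map:
  assumes "strict_mono_on (set s) h"
  shows "LRmin (map h s) = LRmin s"
proof -
  have "h (s ! j) < h (s ! i) \<longleftrightarrow> s ! j < s ! i" if "j < length s" "i < j" for i j
    using that by (intro strict_mono_on_less[OF assms]) auto
  then show ?thesis
    unfolding LRmin_def by (intro arg_cong[where f = card]) auto
qed

text \<open>
  The summand of the series \<open>NM_series\<close> at $x = 1$. The empty word has weight 1, not $y$, in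
  accordance with the constant term of that series.
\<close>

definition avoid_weight :: "nat \<Rightarrow> 'a::field_char_0 \<Rightarrow> nat list \<Rightarrow> 'a" where
  "avoid_weight p y s =
     (if s = [] then 1 else if \<exists>i. match_at (tau p) s i then 0 else y ^ (1 + des s))"

lemma order_invariant_avoid_weight: "order_invariant (avoid_weight p y)"
  by (auto simp: order_invariant_def avoid_weight_def match_at_map des_map)

lemma avoid_weight_Nil [simp]: "avoid_weight p y [] = 1"
  by (simp add: avoid_weight_def)

lemma avoid_weight_single:
  assumes "4 \<le> p"
  shows "avoid_weight p y [a] = y"
  using assms by (auto simp: avoid_weight_def match_at_def)

lemma avoid_weight_Cons_Cons:
  assumes "4 \<le> p" "distinct (a # b # r)"
  shows "avoid_weight p y (a # b # r) =
    (if b < a then y * avoid_weight p y (b # r)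
     else if dip a b r \<and> rising (p - 2) r then 0
     else avoid_weight p y (b # r))"
proof -
  have "(\<exists>i. match_at (tau p) (a # b # r) i) \<longleftrightarrow>
      match_at (tau p) (a # b # r) 0 \<or> (\<exists>i. match_at (tau p) (b # r) i)"
    by (metis match_at_Cons_Suc not0_implies_Suc)
  moreover have "\<not> dip a b r" if "b < a"
    using that by (auto simp: dip_def)
  ultimately show ?thesis
    using match_at_tau_0[OF assms] by (auto simp: avoid_weight_def des_Cons_Cons)
qed

section \<open>The signed brick weight is inverse to the avoidance weight\<close>

text \<open>
  The sum of $(-y)^k$ over the valid cuts of a nonempty word into $k$ bricks whose first brick has
  at least \<open>j\<close> entries; the values 0 and 1 of \<open>j\<close> mean the same. In a word \<open>a # b # r\<close>, a
  descent from \<open>a\<close> to \<open>b\<close> would have to be a cut after a brick with one entry, which leaves no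
  room for the match, so it excludes all cuts. At an ascent, a valid cut of \<open>b # r\<close>
  extends either by the separate brick \<open>[a]\<close>, which gives $-y$, or by adding \<open>a\<close> to its first
  brick. The only further cuts are those with first brick \<open>[a, b]\<close> followed by a descent; they
  require a match at \<open>a\<close>, that is \<open>dip a b r\<close> and a next brick with at least \<open>p - 2\<close> entries.
  The empty word has weight 0, which makes the recursion uniform.
\<close>

fun brick_weight :: "nat \<Rightarrow> 'a::field_char_0 \<Rightarrow> nat \<Rightarrow> nat list \<Rightarrow> 'a" where
  "brick_weight p y j [] = 0"
| "brick_weight p y j [a] = (if j \<le> 1 then - y else 0)"
| "brick_weight p y j (a # b # r) =
    (if \<not> a < b then 0
     else if 3 \<le> j then brick_weight p y (j - 1) (b # r)
     else (if j \<le> 1 then 1 - y else 1) * brick_weight p y 1 (b # r) +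
       (if dip a b r then - y * brick_weight p y (p - 2) r else 0))"

lemma dip_map:
  assumes "strict_mono_on (set (a # b # r)) h"
  shows "dip (h a) (h b) (map h r) \<longleftrightarrow> dip a b r"
proof (cases "2 \<le> length r")
  case True
  then obtain c d t where r: "r = c # d # t"
    by (auto simp: Suc_le_length_iff numeral_2_eq_2)
  have "h a < h c \<longleftrightarrow> a < c" "h c < h b \<longleftrightarrow> c < b" "h b < h d \<longleftrightarrow> b < d"
    using strict_mono_on_less[OF assms] by (simp_all add: r)
  then show ?thesis
    by (simp add: r dip_def)
qed (simp add: dip_def)

lemma order_invariant_brick_weight: "order_invariant (brick_weight p y j)"
proof -
  have "strict_mono_on (set s) h \<Longrightarrow> brick_weight p y j (map h s) = brick_weight p y j s" for h s
  proof (induction p y j s rule: brick_weight.induct)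
    case (3 p y j a b r)
    have sub: "strict_mono_on (set (b # r)) h" "strict_mono_on (set r) h"
      by (rule monotone_on_subset[OF "3.prems"]; auto)+
    have "h a < h b \<longleftrightarrow> a < b"
      using strict_mono_on_less[OF "3.prems"] by simp
    moreover have "dip (h a) (h b) (map h r) \<longleftrightarrow> dip a b r"
      by (rule dip_map[OF "3.prems"])
    ultimately show ?case
      using "3.IH" sub by (cases "a < b"; cases "3 \<le> j"; cases "dip a b r") simp_all
  qed simp_all
  then show ?thesis
    by (simp add: order_invariant_def)
qed

lemma brick_weight_short: "length s < j \<Longrightarrow> brick_weight p y j s = 0"
  by (induction p y j s rule: brick_weight.induct) auto

text \<open>
  Each brick begins with a smaller entry than the next one: at an ascent this is clear, and at a
  descent the next brick begins above the entry that plays the role of 1 in the match.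
\<close>

lemma brick_weight_min_first:
  "brick_weight p y j (a # s) \<noteq> 0 \<Longrightarrow> b \<in> set s \<Longrightarrow> a < b"
proof (induction p y j "a # s" arbitrary: a s b rule: brick_weight.induct)
  case (3 p y j a c r)
  have ac: "a < c"
    using "3.prems"(1) by (auto split: if_splits)
  consider j' where "brick_weight p y j' (c # r) \<noteq> 0" "j' = j - 1 \<and> 3 \<le> j \<or> j' = 1 \<and> \<not> 3 \<le> j"
    | "dip a c r" "brick_weight p y (p - 2) r \<noteq> 0" "\<not> 3 \<le> j"
    using "3.prems"(1) by (fastforce split: if_splits)
  then show ?case
  proof cases
    case 1
    then have "b = c \<or> c < b"
      using "3.hyps"(1,2) "3.prems"(2) ac by auto
    with ac show ?thesis by auto
  next
    case 2
    then obtain d t where r: "r = d # t" "a < d"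
      by (cases r) (auto simp: dip_def)
    then have "b = c \<or> b = d \<or> d < b"
      using "3.hyps"(3)[of d t b] "3.prems"(2) ac 2 by auto
    with ac r show ?thesis by auto
  qed
qed simp_all

lemma rising_Cons_Cons:
  assumes "2 \<le> j"
  shows "rising j (a # b # r) \<longleftrightarrow> a < b \<and> rising (j - 1) (b # r)"
proof -
  obtain i where "j = Suc (Suc i)"
    using assms by (metis Suc_le_D numeral_2_eq_2 Suc_le_mono)
  then show ?thesis
    by (auto simp: rising_def)
qed

context
  fixes p :: nat and y :: "'a::field_char_0"
  assumes p: "5 \<le> p"
begin

private abbreviation "q \<equiv> brick_weight p y"
private abbreviation "g \<equiv> avoid_weight p y"
private abbreviation "K j s \<equiv> (\<Sum>k\<le>length s. q j (take k s) * g (drop k s))"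

text \<open>
  The first part is the cancellation: together with the empty row of bricks, which contributes
  \<open>g s\<close>, all terms sum to 0. It is proved from left to right by induction rather than through
  the pairing, and the second part is what makes the induction work: it prescribes the
  length of the first brick, as needed for the brick that completes a match. The value is
  independent of \<open>j\<close> because no match can begin before the last two entries of a rising start.
\<close>

lemma brick_avoid_convolution:
  assumes "distinct s" "s \<noteq> []"
  shows "K 1 s = - g s \<and> (\<forall>j\<ge>2. K j s = (if rising j s then - g s else 0))"
  using assms
proof (induction s rule: measure_induct_rule[of length])
  case (less s)
  have K_Cons: "K j (b # r) = (\<Sum>k\<le>length r. q j (b # take k r) * g (drop k r))" for j b r
    by (simp add: sum.atMost_Suc_shift del: sum.atMost_Suc)
  consider a where "s = [a]" | a b r where "s = a # b # r"
    using less.prems by (metis list.exhaust)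
  then show ?case
  proof cases
    case 1
    then show ?thesis
      using p by (simp add: avoid_weight_single rising_def)
  next
    case (2 a b r)
    have dist: "distinct (a # b # r)"
      using less.prems 2 by simp
    have IH: "K 1 (b # r) = - g (b # r)"
      "\<And>j. 2 \<le> j \<Longrightarrow> K j (b # r) = (if rising j (b # r) then - g (b # r) else 0)"
      using less.IH[of "b # r"] dist 2 by auto
    have g_s: "g s = (if b < a then y * g (b # r)
       else if dip a b r \<and> rising (p - 2) r then 0 else g (b # r))"
      unfolding 2 using p dist by (intro avoid_weight_Cons_Cons) auto
    have K_s: "K j s = q j [a] * g (b # r) + (\<Sum>k\<le>length r. q j (a # b # take k r) * g (drop k r))" for j
      unfolding 2 by (simp add: sum.atMost_Suc_shift del: sum.atMost_Suc brick_weight.simps(3))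
    show ?thesis
    proof (cases "a < b")
      case False
      then have "K j s = q j [a] * g (b # r)" for j
        unfolding K_s by simp
      moreover have "b < a"
        using False dist by auto
      ultimately show ?thesis
        using False g_s by (simp add: 2 rising_Cons_Cons)
    next
      case True
      (* A prefix of r too short to decide dip a b r is also too short for a brick with p - 2
         entries, so truncation does not matter. *)
      have dip_take: "(if dip a b (take k r) then - y * q (p - 2) (take k r) else 0) =
          (if dip a b r then - y * q (p - 2) (take k r) else 0)" for k
      proof (cases "k < 2")
        case True
        then show ?thesis
          using p by (simp add: brick_weight_short)
      next
        case False
        then show ?thesis
          by (simp add: dip_def)
      qed
      have D: "(\<Sum>k\<le>length r. (if dip a b (take k r) then - y * q (p - 2) (take k r) else 0) * g (drop k r)) =
          (if dip a b r then - y * K (p - 2) r else 0)"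
        unfolding dip_take by (simp add: sum_distrib_left mult.assoc)
      have small: "K j s = q j [a] * g (b # r) + (if j \<le> 1 then 1 - y else 1) * K 1 (b # r) +
          (if dip a b r then - y * K (p - 2) r else 0)" if "j \<le> 2" for j
      proof -
        have "K j s = q j [a] * g (b # r) + (\<Sum>k\<le>length r.
          (if j \<le> 1 then 1 - y else 1) * (q 1 (b # take k r) * g (drop k r)) +
          (if dip a b (take k r) then - y * q (p - 2) (take k r) else 0) * g (drop k r))"
          unfolding K_s using True that
          by (intro arg_cong2[where f = "(+)"] sum.cong refl) (simp add: algebra_simps)
        then show ?thesis
          unfolding K_Cons D[symmetric] by (simp only: sum.distrib sum_distrib_left add.assoc)
      qed
      (* If there is no match at a, either the last term vanishes and g s = g (b # r), or r does
         not rise far enough and K (p - 2) r = 0. At a match g s = 0, and the last term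
         cancels g (b # r) = y * g r. *)
      have D_value: "- g (b # r) + (if dip a b r then - y * K (p - 2) r else 0) = - g s"
      proof (cases "dip a b r")
        case dip: True
        then obtain c t where r: "r = c # t" "c < b"
          by (cases r) (auto simp: dip_def)
        have "g (b # r) = y * g r"
          using r p dist avoid_weight_Cons_Cons[of p b c t y] by auto
        moreover have "K (p - 2) r = (if rising (p - 2) r then - g r else 0)"
          using less.IH[of r] dist 2 r p by auto
        ultimately show ?thesis
          using dip True g_s by auto
      next
        case False
        then show ?thesis
          using True g_s by auto
      qed
      have "K 1 s = - g (b # r) + (if dip a b r then - y * K (p - 2) r else 0)"
        using small[of 1, unfolded IH(1)] by (simp add: algebra_simps)
      then have K1: "K 1 s = - g s"
        unfolding D_value .
      moreover have "K j s = (if rising j s then - g s else 0)" if "2 \<le> j" for j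
      proof (cases "j = 2")
        case j: True
        have "rising 2 s"
          using True by (simp add: 2 rising_Cons_Cons) (simp add: rising_def)
        then show ?thesis
          using j small[of 2, unfolded IH(1)] D_value by simp
      next
        case False
        then have j: "3 \<le> j"
          using that by simp
        then have "K j s = K (j - 1) (b # r)"
          unfolding K_s K_Cons using True by simp
        also have "\<dots> = (if rising (j - 1) (b # r) then - g (b # r) else 0)"
          using IH(2) j by simp
        also have "\<dots> = (if rising j s then - g s else 0)"
        proof (cases "rising (j - 1) (b # r)")
          case rising: True
          then obtain c t where r: "r = c # t"
            using j by (cases r) (auto simp: rising_def)
          then have "b < c"
            using rising j rising_Cons_Cons[of "j - 1" b c t] by simp
          then have "\<not> dip a b r"
            by (auto simp: dip_def r)
          then show ?thesis
            using rising True j g_s by (auto simp: 2 rising_Cons_Cons)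
        next
          case False
          then show ?thesis
            using j by (simp add: 2 rising_Cons_Cons)
        qed
        finally show ?thesis .
      qed
      ultimately show ?thesis by blast
    qed
  qed
qed

section \<open>Summing the brick weight over permutations\<close>

private abbreviation "Q j n \<equiv> perm_sum (brick_weight p y j) {1..n}"

text \<open>
  \<open>dip_rest (b # r)\<close> is the contribution to the weight of \<open>a # b # r\<close> of the cuts with first brick
  \<open>[a, b]\<close> followed by a descent, when \<open>a\<close> is below all other entries. Expressed without \<open>a\<close>
  it is an order-invariant weight. Its only nonzero values occur when \<open>r\<close> begins with the minimum,
  and deleting that entry turns it into \<open>ascent_rest\<close>.
\<close>

definition dip_rest :: "nat list \<Rightarrow> 'a" where
  "dip_rest s = (if 3 \<le> length s \<and> s ! 1 < s ! 0 \<and> s ! 0 < s ! 2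
     then - y * brick_weight p y (p - 2) (tl s) else 0)"

definition ascent_rest :: "nat list \<Rightarrow> 'a" where
  "ascent_rest s = (if 2 \<le> length s \<and> s ! 0 < s ! 1
     then - y * brick_weight p y (p - 3) (tl s) else 0)"

private abbreviation "R n \<equiv> perm_sum dip_rest {1..n}"

lemma brick_weight_min_head: "u \<noteq> [] \<Longrightarrow> brick_weight p y j (u @ 0 # v) = 0"
  using brick_weight_min_first[of p y j "hd u" "tl u @ 0 # v" 0] by (cases u) auto

lemma order_invariant_rest: "order_invariant dip_rest" "order_invariant ascent_rest"
proof -
  have tl: "brick_weight p y j (tl (map h s)) = brick_weight p y j (tl s)"
    if "strict_mono_on (set s) h" for h s j
    unfolding map_tl[symmetric]
    by (intro order_invariantD[OF order_invariant_brick_weight] monotone_on_subset[OF that])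
      (cases s; auto)
  have nth: "h (s ! i) < h (s ! j) \<longleftrightarrow> s ! i < s ! j"
    if "strict_mono_on (set s) h" "i < length s" "j < length s" for h :: "nat \<Rightarrow> nat" and s i j
    using that by (intro strict_mono_on_less[OF that(1)]) auto
  show "order_invariant dip_rest"
    unfolding order_invariant_def
  proof (intro allI impI)
    fix h :: "nat \<Rightarrow> nat" and s assume h: "strict_mono_on (set s) h"
    show "dip_rest (map h s) = dip_rest s"
      using tl[OF h] nth[OF h] by (cases "s = []"; cases "3 \<le> length s") (auto simp: dip_rest_def)
  qed
  show "order_invariant ascent_rest"
    unfolding order_invariant_def
  proof (intro allI impI)
    fix h :: "nat \<Rightarrow> nat" and s assume h: "strict_mono_on (set s) h"
    show "ascent_rest (map h s) = ascent_rest s"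
      using tl[OF h] nth[OF h] by (cases "s = []"; cases "2 \<le> length s") (auto simp: ascent_rest_def)
  qed
qed

lemma perm_sum_brick_head:
  "perm_sum (brick_weight p y j) {1..Suc n} = perm_sum (\<lambda>s. brick_weight p y j (0 # s)) {1..n}"
  by (rule perm_sum_min_head[OF order_invariant_brick_weight brick_weight_min_head])

text \<open>
  If the first brick has at least three entries, then deleting the first of them leaves at least
  two, and the condition at the next cut depends only on its last two entries.
\<close>

lemma perm_sum_brick_shift:
  assumes "2 \<le> j"
  shows "Q (Suc j) (Suc n) = Q j n"
  unfolding perm_sum_brick_head
proof (rule perm_sum_cong)
  fix s assume "distinct s" "set s = {1..n}"
  then have "0 \<notin> set s" by simp
  then show "q (Suc j) (0 # s) = q j s"
    using assms by (cases s) auto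
qed

lemma perm_sum_brick_shift_iter: "Q (2 + i) (n + i) = Q 2 n"
  by (induction i) (simp_all add: perm_sum_brick_shift del: One_nat_def)

lemma perm_sum_brick_short:
  assumes "n < j"
  shows "Q j n = 0"
proof -
  have "Q j n = perm_sum (\<lambda>_. 0) {1..n}"
    by (rule perm_sum_cong) (use assms in \<open>simp only: length_eqI brick_weight_short\<close>)
  then show ?thesis
    by (simp add: perm_sum_def)
qed

lemma perm_sum_brick_step:
  assumes "1 \<le> n" "j \<in> {1, 2}"
  shows "Q j (Suc n) = (if j = 1 then 1 - y else 1) * Q 1 n + R n"
proof -
  have "Q j (Suc n) = perm_sum (\<lambda>s. (if j = 1 then 1 - y else 1) * q 1 s + dip_rest s) {1..n}"
    unfolding perm_sum_brick_head
  proof (rule perm_sum_cong)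
    fix s assume s: "distinct s" "set s = {1..n}"
    then obtain b r where br: "s = b # r"
      using assms by (cases s) auto
    have "0 \<notin> set s"
      using s(2) by simp
    then have b: "0 < b" and "0 \<notin> set r"
      by (auto simp: br)
    then have "dip 0 b r \<longleftrightarrow> 3 \<le> length s \<and> s ! 1 < s ! 0 \<and> s ! 0 < s ! 2"
      by (cases r) (auto simp: dip_def br)
    then have "dip_rest s = (if dip 0 b r then - y * q (p - 2) r else 0)"
      by (simp add: dip_rest_def br)
    moreover have "q j (0 # b # r) = (if j = 1 then 1 - y else 1) * q 1 (b # r) +
        (if dip 0 b r then - y * q (p - 2) r else 0)"
      using b assms(2) by (subst brick_weight.simps(3)) auto
    ultimately show "q j (0 # s) = (if j = 1 then 1 - y else 1) * q 1 s + dip_rest s"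
      by (simp only: br)
  qed
  then show ?thesis
    by (simp add: perm_sum_def sum.distrib sum_distrib_left)
qed

text \<open>
  A contributing word has its minimum in the second place, where the brick after the descent
  begins. Once it is deleted, all that remains of the dip is that the word begins with an ascent,
  and one entry fewer is prescribed for the brick.
\<close>

lemma perm_sum_dip_rest_insert: "R (Suc n) = perm_sum ascent_rest {1..n}"
  unfolding perm_sum_insert_min[OF order_invariant_rest(1)]
proof (rule perm_sum_cong)
  fix s assume s: "distinct s" "set s = {1..n}"
  then have len: "length s = n" and pos: "0 \<notin> set s"
    by (rule length_eqI) (use s in simp)
  have zero: "dip_rest (take k s @ 0 # drop k s) = 0" if kn: "k \<noteq> 1" "k \<le> n" for k
  proof (cases "k = 0")
    case True
    then show ?thesis
      by (simp add: dip_rest_def)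
  next
    case False
    then obtain i where k: "k = Suc (Suc i)"
      using kn(1) by (cases k; cases "k - 1") auto
    then have "Suc (Suc i) \<le> length s"
      using kn(2) len by simp
    then obtain a b u where "s = a # b # u"
      by (auto simp: Suc_le_length_iff)
    with k have u: "take k s = a # b # take i u"
      by simp
    then show ?thesis
      using brick_weight_min_head[of "b # take i u" "p - 2" "drop k s"]
      by (simp add: dip_rest_def)
  qed
  show "(\<Sum>k\<le>n. dip_rest (take k s @ 0 # drop k s)) = ascent_rest s"
  proof (cases s)
    case Nil
    then show ?thesis
      using len by (simp add: ascent_rest_def dip_rest_def)
  next
    case (Cons b t)
    have "(\<Sum>k\<le>n. dip_rest (take k s @ 0 # drop k s)) =
        (\<Sum>k\<in>{1}. dip_rest (take k s @ 0 # drop k s))"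
    proof (rule sum.mono_neutral_right)
      show "{1} \<subseteq> {..n}"
        using len Cons by auto
      show "\<forall>k\<in>{..n} - {1}. dip_rest (take k s @ 0 # drop k s) = 0"
        by (auto intro: zero)
    qed simp
    also have "\<dots> = dip_rest (b # 0 # t)"
      using Cons by simp
    also have "\<dots> = ascent_rest s"
    proof (cases t)
      case Nil
      then show ?thesis
        by (simp add: Cons dip_rest_def ascent_rest_def)
    next
      case (Cons c u)
      have "0 < b" "0 < c" "p - 2 - 1 = p - 3" "3 \<le> p - 2"
        using pos p \<open>s = b # t\<close> Cons by auto
      moreover have "q (p - 2) (0 # c # u) = q (p - 2 - 1) (c # u)"
        using \<open>3 \<le> p - 2\<close> \<open>0 < c\<close> by (subst brick_weight.simps(3)) simp
      ultimately show ?thesis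
        by (simp add: \<open>s = b # t\<close> Cons dip_rest_def ascent_rest_def del: brick_weight.simps)
    qed
    finally show ?thesis .
  qed
qed

lemma perm_sum_ascent_rest: "perm_sum ascent_rest {1..Suc n} = - y * Q (p - 3) n"
proof -
  have "perm_sum ascent_rest {1..Suc n} = perm_sum (\<lambda>s. ascent_rest (0 # s)) {1..n}"
  proof (rule perm_sum_min_head[OF order_invariant_rest(2)])
    fix u v :: "nat list" assume "u \<noteq> []"
    then obtain a w where u: "u = a # w"
      by (cases u) auto
    show "ascent_rest (u @ 0 # v) = 0"
      using brick_weight_min_head[of w "p - 3" v] by (cases w) (auto simp: u ascent_rest_def)
  qed
  also have "\<dots> = perm_sum (\<lambda>s. - y * brick_weight p y (p - 3) s) {1..n}"
  proof (rule perm_sum_cong)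
    fix s assume "distinct s" "set s = {1..n}"
    then have "0 \<notin> set s" by simp
    then show "ascent_rest (0 # s) = - y * brick_weight p y (p - 3) s"
      by (cases s) (auto simp: ascent_rest_def)
  qed
  finally show ?thesis
    by (simp add: perm_sum_def sum_distrib_left)
qed

lemma perm_sum_dip_rest_low:
  assumes "n \<le> p - 2"
  shows "R n = 0"
proof -
  consider "n = 0" | "n = 1" | m where "n = Suc (Suc m)"
    by (metis One_nat_def not0_implies_Suc)
  then show ?thesis
  proof cases
    case 1
    then show ?thesis
      by (simp add: perm_sum_def dip_rest_def)
  next
    case 2
    then show ?thesis
      using perm_sum_dip_rest_insert[of 0] by (simp add: perm_sum_def ascent_rest_def)
  next
    case (3 m)
    then show ?thesis
      using perm_sum_dip_rest_insert[of "Suc m"] perm_sum_ascent_rest[of m]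
        perm_sum_brick_short[of m "p - 3"] assms p by simp
  qed
qed

text \<open>
  The step behind the sum over \<open>k\<close> in the recurrence. The first \<open>p - 3\<close> entries of the brick after
  the descent are the smallest ones left. All but the last of these can be deleted, and the last
  one is then the leading minimum of a shorter word whose first brick has at least two entries.
\<close>

lemma perm_sum_dip_rest_high:
  assumes "1 \<le> n"
  shows "R (n + (p - 2)) = - y * (Q 1 n + R n)"
proof -
  obtain i where i: "p = 5 + i"
    using p le_Suc_ex by blast
  have "R (n + (p - 2)) = R (Suc (Suc (Suc n + i)))"
    by (simp add: i numeral_eq_Suc)
  also have "\<dots> = - y * Q (2 + i) (Suc n + i)"
    unfolding perm_sum_dip_rest_insert perm_sum_ascent_rest by (simp add: i)
  also have "Q (2 + i) (Suc n + i) = Q 1 n + R n"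
    unfolding perm_sum_brick_shift_iter using perm_sum_brick_step[OF assms, of 2] by simp
  finally show ?thesis .
qed

lemma perm_sum_dip_rest:
  "1 \<le> n \<Longrightarrow> R n = (\<Sum>k = 1..(n - 1) div (p - 2). (- y) ^ k * Q 1 (n - k * (p - 2)))"
proof (induction n rule: less_induct)
  case (less n)
  show ?case
  proof (cases "n \<le> p - 2")
    case True
    then have "(n - 1) div (p - 2) = 0"
      using less.prems by (intro div_less) simp
    then show ?thesis
      using perm_sum_dip_rest_low[OF True] by simp
  next
    case False
    define m where "m = n - (p - 2)"
    have m: "1 \<le> m" "n = m + (p - 2)" "m < n"
      using False p by (auto simp: m_def)
    define N where "N = (m - 1) div (p - 2)"
    have "n - 1 = (m - 1) + (p - 2)"
      using m by simp
    then have N: "(n - 1) div (p - 2) = Suc N"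
      using p by (simp only: N_def div_add_self2)
    have "R n = - y * (Q 1 m + (\<Sum>k = 1..N. (- y) ^ k * Q 1 (m - k * (p - 2))))"
      using perm_sum_dip_rest_high[OF m(1)] less.IH[OF m(3,1)] m(2) by (simp only: N_def)
    also have "\<dots> = (- y) ^ 1 * Q 1 (n - 1 * (p - 2)) +
        (\<Sum>k = 1..N. (- y) ^ Suc k * Q 1 (n - Suc k * (p - 2)))"
    proof -
      have "n - 1 * (p - 2) = m" "n - Suc k * (p - 2) = m - k * (p - 2)" for k
        unfolding m(2) by simp_all
      then show ?thesis
        by (simp only: distrib_left sum_distrib_left power_Suc power_0 mult_1_right One_nat_def
            mult.assoc)
    qed
    also have "\<dots> = (\<Sum>k = 1..Suc N. (- y) ^ k * Q 1 (n - k * (p - 2)))"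
    proof -
      have "f 1 + (\<Sum>k = 1..N. f (Suc k)) = (\<Sum>k = 1..Suc N. f k)" for f :: "nat \<Rightarrow> 'a"
        by (induction N) (simp_all add: add.assoc)
      then show ?thesis .
    qed
    finally show ?thesis
      by (simp only: N)
  qed
qed

lemma U_coeff_eq_perm_sum: "1 \<le> n \<Longrightarrow> U_coeff p y n = Q 1 n"
proof (induction n rule: less_induct)
  case (less n)
  show ?case
  proof (cases "n = 1")
    case True
    then show ?thesis
      by (simp add: U_coeff.simps perm_sum_def permutations_of_set_singleton)
  next
    case False
    define m where "m = n - 1"
    have m: "n = Suc m" "1 \<le> m"
      using False less.prems by (auto simp: m_def)
    have "U_coeff p y n = (1 - y) * U_coeff p y m +
        (\<Sum>k = 1..(m - 1) div (p - 2). (- y) ^ k * U_coeff p y (m - k * (p - 2)))"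
      using m by (subst U_coeff.simps) (simp add: numeral_2_eq_2)
    also have "\<dots> = (1 - y) * Q 1 m +
        (\<Sum>k = 1..(m - 1) div (p - 2). (- y) ^ k * Q 1 (m - k * (p - 2)))"
    proof (intro arg_cong2[where f = "(+)"] arg_cong2[where f = "(*)"] sum.cong refl)
      show "U_coeff p y m = Q 1 m"
        using less.IH[of m] m by simp
      fix k assume "k \<in> {1..(m - 1) div (p - 2)}"
      then have "k * (p - 2) \<le> m - 1"
        using p by (simp add: less_eq_div_iff_mult_less_eq)
      then show "U_coeff p y (m - k * (p - 2)) = Q 1 (m - k * (p - 2))"
        using less.IH[of "m - k * (p - 2)"] m by simp
    qed
    also have "\<dots> = (1 - y) * Q 1 m + R m"
      by (simp only: perm_sum_dip_rest[OF m(2)])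
    also have "\<dots> = Q 1 n"
      using perm_sum_brick_step[OF m(2), of 1] m by simp
    finally show ?thesis .
  qed
qed

end

section \<open>Cutting at the minimum\<close>

definition full_weight :: "nat \<Rightarrow> 'a::field_char_0 \<Rightarrow> 'a \<Rightarrow> nat list \<Rightarrow> 'a" where
  "full_weight p x y s = avoid_weight p y s * x ^ LRmin s"

text \<open>
  The entries are raised by one so that 0 is below all of them for every word, as order invariance
  requires. On words of positive entries the shift can be left out.
\<close>

definition min_first_weight :: "nat \<Rightarrow> 'a::field_char_0 \<Rightarrow> nat list \<Rightarrow> 'a" where
  "min_first_weight p y s = avoid_weight p y (0 # map Suc s)"

lemma order_invariant_full_weight: "order_invariant (full_weight p x y)"
  using order_invariant_avoid_weight[of p y]
  by (auto simp: order_invariant_def full_weight_def LRmin_map)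

lemma order_invariant_min_first_weight: "order_invariant (min_first_weight p y)"
  unfolding order_invariant_def
proof (intro allI impI)
  fix h :: "nat \<Rightarrow> nat" and s assume h: "strict_mono_on (set s) h"
  define h' where "h' i = (if i = 0 then 0 else Suc (h (i - 1)))" for i
  have "strict_mono_on (set (0 # map Suc s)) h'"
    by (rule strict_mono_onI) (use strict_mono_onD[OF h] in \<open>auto simp: h'_def\<close>)
  then have "avoid_weight p y (map h' (0 # map Suc s)) = avoid_weight p y (0 # map Suc s)"
    by (rule order_invariantD[OF order_invariant_avoid_weight])
  moreover have "map h' (0 # map Suc s) = 0 # map Suc (map h s)"
    by (simp add: h'_def)
  ultimately show "min_first_weight p y (map h s) = min_first_weight p y s"
    by (simp only: min_first_weight_def)
qed

lemma min_first_weight_eq: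
  assumes "0 \<notin> set s"
  shows "min_first_weight p y s = avoid_weight p y (0 # s)"
proof -
  define h where "h i = (if i = 0 then 0 else Suc i)" for i :: nat
  have "strict_mono_on (set (0 # s)) h"
    by (rule strict_mono_onI) (auto simp: h_def)
  then have "avoid_weight p y (map h (0 # s)) = avoid_weight p y (0 # s)"
    by (rule order_invariantD[OF order_invariant_avoid_weight])
  moreover have "map h (0 # s) = 0 # map Suc s"
    using assms by (auto simp: h_def intro!: gr0I)
  ultimately show ?thesis
    by (simp only: min_first_weight_def)
qed

text \<open>
  A match that meets both \<open>u\<close> and the entry 0 would have its minimum after its first position,
  whereas \<open>tau p\<close> begins with 1.
\<close>

lemma match_split_min:
  fixes u v :: "nat list"
  assumes "3 \<le> p" "0 \<notin> set u"
  shows "(\<exists>i. match_at (tau p) (u @ 0 # v) i) \<longleftrightarrow>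
    (\<exists>i. match_at (tau p) u i) \<or> (\<exists>i. match_at (tau p) (0 # v) i)"
proof safe
  fix i assume m: "match_at (tau p) (u @ 0 # v) i"
    and no: "\<nexists>i. match_at (tau p) (0 # v) i"
  have im: "i + p \<le> length (u @ 0 # v)" "red (take p (drop i (u @ 0 # v))) = tau p"
    using m assms(1) by (auto simp: match_at_def)
  consider "length u \<le> i" | "i + p \<le> length u" | "i < length u" "length u < i + p"
    by linarith
  then show "\<exists>i. match_at (tau p) u i"
  proof cases
    case 1
    then have "match_at (tau p) (0 # v) (i - length u)"
      using im assms(1) by (simp add: match_at_def)
    with no show ?thesis by blast
  next
    case 2
    then show ?thesis
      using im assms(1) by (intro exI[of _ i]) (simp add: match_at_def)
  next
    case 3
    define w where "w = take p (drop i (u @ 0 # v))"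
    have w: "length w = p" "red w = tau p"
      using im by (simp_all add: w_def)
    have j: "length u - i < p"
      using 3 by simp
    have "w ! (length u - i) = 0"
      using 3 j by (simp add: w_def nth_append)
    moreover have "w ! 0 = u ! i"
      using 3 assms(1) by (simp add: w_def nth_append)
    moreover have "u ! i \<noteq> 0"
      using 3 assms(2) nth_mem[of i u] by metis
    ultimately have "tau p ! (length u - i) < tau p ! 0"
      using red_nth_less_iff[of "length u - i" w 0] w j assms(1) by simp
    then show ?thesis
      using j assms(1) by (simp add: nth_tau split: if_splits)
  qed
next
  fix i assume "match_at (tau p) u i"
  then have "match_at (tau p) (u @ 0 # v) i"
    using assms(1) by (auto simp: match_at_def)
  then show "\<exists>i. match_at (tau p) (u @ 0 # v) i" ..
next
  fix i assume "match_at (tau p) (0 # v) i"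
  then have "match_at (tau p) (u @ 0 # v) (length u + i)"
    using assms(1) by (auto simp: match_at_def)
  then show "\<exists>i. match_at (tau p) (u @ 0 # v) i" ..
qed

lemma des_split_min:
  fixes u v :: "nat list"
  assumes "0 \<notin> set u"
  shows "des (u @ 0 # v) = (if u = [] then 0 else Suc (des u)) + des (0 # v)"
  using assms
proof (induction u rule: induct_list012)
  case (2 a)
  then show ?case
    by (simp add: des_Cons_Cons)
next
  case (3 a b u)
  then show ?case
    by (simp add: des_Cons_Cons)
qed simp

lemma avoid_weight_split_min:
  assumes "3 \<le> p" "0 \<notin> set u"
  shows "avoid_weight p y (u @ 0 # v) = avoid_weight p y u * avoid_weight p y (0 # v)"
proof (cases "u = []")
  case False
  then show ?thesis
    unfolding avoid_weight_def match_split_min[OF assms] des_split_min[OF assms(2)]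
    by (auto simp: power_add)
qed simp

lemma LRmin_split_min:
  fixes u v :: "nat list"
  assumes "0 \<notin> set u"
  shows "LRmin (u @ 0 # v) = Suc (LRmin u)"
proof -
  let ?m = "\<lambda>s :: nat list. {j. j < length s \<and> (\<forall>i<j. s ! j < s ! i)}"
  have "j \<in> ?m (u @ 0 # v) \<longleftrightarrow> j \<in> insert (length u) (?m u)" for j
  proof -
    consider "j < length u" | "j = length u" | "length u < j"
      by linarith
    then show ?thesis
    proof cases
      case 2
      have "0 < u ! i" if "i < length u" for i
        using that assms nth_mem[of i u] by (metis gr0I)
      with 2 show ?thesis
        by (auto simp: nth_append)
    next
      case 3
      have "\<not> (u @ 0 # v) ! j < (u @ 0 # v) ! length u"
        by simp
      with 3 show ?thesis
        by auto
    qed (auto simp: nth_append)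
  qed
  then have "?m (u @ 0 # v) = insert (length u) (?m u)"
    by blast
  then show ?thesis
    by (simp add: LRmin_def)
qed

lemma full_weight_split_min:
  assumes "3 \<le> p" "0 \<notin> set u" "0 \<notin> set v"
  shows "full_weight p x y (u @ 0 # v) = x * full_weight p x y u * min_first_weight p y v"
  using assms
  by (simp add: full_weight_def avoid_weight_split_min LRmin_split_min min_first_weight_eq)

section \<open>The differential equation\<close>

lemma egf_cong:
  assumes "\<And>s. distinct s \<Longrightarrow> 0 \<notin> set s \<Longrightarrow> f s = g s"
  shows "egf f = egf g"
proof -
  have "perm_sum f {1..n} = perm_sum g {1..n}" for n
    by (rule perm_sum_cong) (use assms in auto)
  then show ?thesis
    by (simp only: egf_def)
qed

text \<open>
  Differentiation marks the minimum, and the minimum contributes one left-to-right minimum while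
  no entry after it contributes any.
\<close>

lemma egf_full_weight_deriv:
  fixes x y :: "'a::field_char_0"
  assumes "3 \<le> p"
  shows "fps_deriv (egf (full_weight p x y)) =
    egf (full_weight p x y) * (fps_const x * egf (min_first_weight p y))"
proof -
  have "fps_deriv (egf (full_weight p x y)) = egf (\<lambda>s. \<Sum>k\<le>length s.
      (x * full_weight p x y (take k s)) * min_first_weight p y (drop k s))"
    unfolding egf_deriv[OF order_invariant_full_weight]
  proof (rule egf_cong)
    fix s :: "nat list" assume "0 \<notin> set s"
    then have "0 \<notin> set (take k s)" "0 \<notin> set (drop k s)" for k
      using in_set_takeD in_set_dropD by metis+
    then show "(\<Sum>k\<le>length s. full_weight p x y (take k s @ 0 # drop k s)) =
        (\<Sum>k\<le>length s. x * full_weight p x y (take k s) * min_first_weight p y (drop k s))"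
      using assms by (simp add: full_weight_split_min)
  qed
  also have "\<dots> = egf (\<lambda>s. x * full_weight p x y s) * egf (min_first_weight p y)"
    using order_invariant_full_weight[of p x y]
    by (intro egf_mult[symmetric] order_invariant_min_first_weight)
      (simp add: order_invariant_def)
  also have "egf (\<lambda>s. x * full_weight p x y s) = fps_const x * egf (full_weight p x y)"
    by (rule fps_ext) (simp add: egf_def perm_sum_def sum_distrib_left)
  finally show ?thesis
    by (simp only: mult_ac)
qed

lemma NM_series_eq_egf: "NM_series (tau p) x y = egf (full_weight p x y)"
proof (rule fps_ext)
  fix n
  have "(\<Sum>s\<in>NM_set (tau p) n. x ^ LRmin s * y ^ (1 + des s)) = perm_sum (full_weight p x y) {1..n}"
    if "n \<noteq> 0"
    unfolding perm_sum_def
  proof (rule sum.mono_neutral_cong_left)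
    fix s assume "s \<in> NM_set (tau p) n"
    then have "s \<noteq> []" "\<nexists>i. match_at (tau p) s i"
      using that by (auto simp: NM_set_def permutations_of_set_def)
    then show "x ^ LRmin s * y ^ (1 + des s) = full_weight p x y s"
      by (auto simp add: full_weight_def avoid_weight_def)
  next
    show "\<forall>s\<in>permutations_of_set {1..n} - NM_set (tau p) n. full_weight p x y s = 0"
      using that by (auto simp: full_weight_def avoid_weight_def NM_set_def permutations_of_set_def)
  qed (auto simp: NM_set_def)
  then show "fps_nth (NM_series (tau p) x y) n = fps_nth (egf (full_weight p x y)) n"
    by (simp add: NM_series_def egf_def perm_sum_def full_weight_def LRmin_def)
qed

lemma U_series_mult_egf_avoid_weight:
  fixes y :: "'a::field_char_0"
  assumes "5 \<le> p"
  shows "U_series p y * egf (avoid_weight p y) = 1"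
proof -
  define u where "u s = (if s = [] then 1 else brick_weight p y 1 s)" for s
  have inv: "order_invariant u"
    using order_invariant_brick_weight[of p y 1] by (simp add: order_invariant_def u_def)
  have "U_series p y = egf u"
  proof (rule fps_ext)
    fix n
    have "perm_sum u {1..n} = perm_sum (brick_weight p y 1) {1..n}" if "1 \<le> n"
      by (rule perm_sum_cong) (use that in \<open>auto simp: u_def\<close>)
    then have "U_coeff p y n = perm_sum u {1..n}"
      using U_coeff_eq_perm_sum[OF assms, of n y]
      by (cases "n = 0") (auto simp: U_coeff.simps[of p y 0] perm_sum_def u_def)
    then show "fps_nth (U_series p y) n = fps_nth (egf u) n"
      by (simp add: U_series_def egf_def)
  qed
  moreover have "egf u * egf (avoid_weight p y) =
      egf (\<lambda>s. \<Sum>k\<le>length s. u (take k s) * avoid_weight p y (drop k s))"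
    by (intro egf_mult inv order_invariant_avoid_weight)
  moreover have "\<dots> = egf (\<lambda>s. if s = [] then 1 else 0)"
  proof (rule egf_cong)
    fix s :: "nat list" assume s: "distinct s"
    show "(\<Sum>k\<le>length s. u (take k s) * avoid_weight p y (drop k s)) = (if s = [] then 1 else 0)"
    proof (cases s)
      case Nil
      then show ?thesis
        by (simp add: u_def)
    next
      case (Cons a r)
      have "(\<Sum>k\<le>length s. u (take k s) * avoid_weight p y (drop k s)) = avoid_weight p y s +
          (\<Sum>k\<le>length s. brick_weight p y 1 (take k s) * avoid_weight p y (drop k s))"
        by (simp add: Cons u_def sum.atMost_Suc_shift del: sum.atMost_Suc)
      then show ?thesis
        using brick_avoid_convolution[OF assms s, of y] Cons by simp
    qed
  qed
  moreover have "egf (\<lambda>s. if s = [] then 1 else 0 :: 'a) = 1"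
  proof (rule fps_ext)
    fix n
    have "perm_sum (\<lambda>s. if s = [] then 1 else 0 :: 'a) {1..n} = (if n = 0 then 1 else 0)"
    proof (cases "n = 0")
      case False
      then have "perm_sum (\<lambda>s. if s = [] then 1 else 0 :: 'a) {1..n} = perm_sum (\<lambda>_. 0) {1..n}"
        by (intro perm_sum_cong) auto
      with False show ?thesis
        by (simp add: perm_sum_def)
    qed (simp add: perm_sum_def)
    then show "fps_nth (egf (\<lambda>s. if s = [] then 1 else 0 :: 'a)) n = fps_nth 1 n"
      by (simp add: egf_def)
  qed
  ultimately show ?thesis
    by simp
qed

text \<open>
  The coefficients of a solution are determined in succession, as the factor \<open>n\<close> produced by
  differentiation is invertible in characteristic 0.
\<close>

lemma fps_linear_ode_unique:
  fixes F G C :: "'a::field_char_0 fps"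
  assumes "fps_deriv F = F * C" "fps_deriv G = G * C" "fps_nth F 0 = fps_nth G 0"
  shows "F = G"
proof (rule fps_ext)
  fix n
  show "fps_nth F n = fps_nth G n"
  proof (induction n rule: less_induct)
    case (less n)
    show ?case
    proof (cases n)
      case (Suc m)
      have "of_nat (Suc m) * fps_nth F (Suc m) = fps_nth (F * C) m"
        using assms(1) fps_deriv_nth[of F m] by simp
      also have "\<dots> = fps_nth (G * C) m"
        unfolding fps_mult_nth using less.IH by (intro sum.cong) (auto simp: Suc)
      also have "\<dots> = of_nat (Suc m) * fps_nth G (Suc m)"
        using assms(2) fps_deriv_nth[of G m] by simp
      finally show ?thesis
        by (simp add: Suc del: of_nat_Suc)
    qed (use assms(3) in simp)
  qed
qed

lemma fps_log_deriv:
  fixes U :: "'a::field_char_0 fps"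
  assumes "fps_nth U 0 = 1"
  shows "fps_deriv (fps_log U) = inverse U * fps_deriv U"
proof -
  have U0: "fps_nth (U - 1) 0 = 0"
    using assms by simp
  have "inverse (1 + fps_X) oo (U - 1) = inverse ((1 + fps_X) oo (U - 1))"
    by (rule fps_inverse_compose[OF U0]) simp
  also have "(1 + fps_X) oo (U - 1) = U"
    by (simp add: fps_compose_add_distrib fps_X_fps_compose_startby0[OF U0])
  finally show ?thesis
    unfolding fps_log_def fps_compose_deriv[OF U0] by (simp add: fps_ln_deriv)
qed

lemma fps_recip_powr_deriv:
  fixes U :: "'a::field_char_0 fps"
  assumes "fps_nth U 0 = 1"
  shows "fps_deriv (fps_recip_powr U x) =
    fps_recip_powr U x * (- fps_const x * (inverse U * fps_deriv U))"
proof -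
  have "fps_nth (- fps_const x * fps_log U) 0 = 0"
    by (simp add: fps_log_def fps_compose_nth fps_ln_def)
  then have "fps_deriv (fps_recip_powr U x) =
      (fps_deriv (fps_exp 1) oo (- fps_const x * fps_log U)) * fps_deriv (- fps_const x * fps_log U)"
    unfolding fps_recip_powr_def by (rule fps_compose_deriv)
  then show ?thesis
    by (simp add: fps_recip_powr_def fps_log_deriv[OF assms])
qed

theorem theorem6:
  fixes p :: nat and x y :: "'a::field_char_0"
  assumes "p \<ge> 5"
  shows "NM_series (tau p) x y = fps_recip_powr (U_series p y) x"
proof (rule fps_linear_ode_unique)
  let ?U = "U_series p y" and ?N = "egf (avoid_weight p y)" and ?B = "egf (min_first_weight p y)"
  have U0: "fps_nth ?U 0 = 1"
    by (simp add: U_series_def U_coeff.simps)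
  have UN: "?U * ?N = 1"
    using assms by (rule U_series_mult_egf_avoid_weight)
  have "full_weight p 1 y = avoid_weight p y"
    by (rule ext) (simp add: full_weight_def)
  then have N': "fps_deriv ?N = ?N * ?B"
    using egf_full_weight_deriv[of p 1 y] assms by simp
  have "fps_deriv (?U * ?N) = 0"
    using UN by simp
  then have "?N * fps_deriv ?U + (?U * ?N) * ?B = 0"
    by (simp add: N' mult_ac add.commute)
  then have "?N * fps_deriv ?U = - ?B"
    using UN by (simp add: eq_neg_iff_add_eq_0)
  moreover have "inverse ?U = ?N"
    using UN by (rule fps_inverse_unique)
  ultimately show "fps_deriv (fps_recip_powr ?U x) = fps_recip_powr ?U x * (fps_const x * ?B)"
    using fps_recip_powr_deriv[OF U0, of x] by (simp del: fps_const_neg)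
  show "fps_deriv (NM_series (tau p) x y) = NM_series (tau p) x y * (fps_const x * ?B)"
    unfolding NM_series_eq_egf using assms by (intro egf_full_weight_deriv) simp
  show "fps_nth (NM_series (tau p) x y) 0 = fps_nth (fps_recip_powr ?U x) 0"
    by (simp add: NM_series_def fps_recip_powr_def)
qed

end
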